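(* For each $j\in[m]$, let $\{\Lambda_{ij}\}_{i\in I}$ be a g-frame for $\mathcal H$ with bounds $A_j$ and $B_j$. Suppose there exists $K>0$ such that $$\sum_{i\in J}\|(\Lambda_{ij}-\Lambda_{il})f\|^2\le K\min\Big\{\sum_{i\in J}\|\Lambda_{ij}f\|^2,\ \sum_{i\in J}\|\Lambda_{il}f\|^2\Big\}\qquad (j,l\in[m],\ j\neq l)$$ for all $f\in\mathcal H$ and all subsets $J\subset I$. Then the family of g-frames $\{\{\Lambda_{ij}\}_{i\in I}:j\in[m]\}$ is woven with universal lower and upper frame bounds $$\frac{\sum_{j\in[m]}A_j}{2(m-1)(K+1)+1}\quad\text{and}\quad\sum_{j\in[m]}B_j .$$
   Context: $\mathcal H$ and $\mathcal K$ are Hilbert spaces, $I\subset\mathbb N$, $\{\mathcal H_i\}_{i\in I}$ is a sequence of closed subspaces of $\mathcal K$, $\Lambda_{ij}\in L(\mathcal H,\mathcal H_i)$ are bounded linear operators, and $[m]=\{1,\dots,m\}$. A family of operators is a g-frame for $\mathcal H$ with bounds $A,B$ if $A,B>0$ are constants such that, for all $f\in\mathcal H$, the sum of $\|\Lambda f\|^2$ over the members $\Lambda$ of the family lies between $A\|f\|^2$ and $B\|f\|^2$. A partition $\{\sigma_j\}_{j\in[m]}$ of $I$ is a family of pairwise disjoint (possibly empty) subsets whose union is $I$. A family of g-frames $\{\Lambda_{ij}\}_{i\in I,j\in[m]}$ is woven with universal bounds $A,B$ if for every partition $\{\sigma_j\}_{j\in[m]}$ of $I$ the family $\{\Lambda_{ij}\}_{i\in\sigma_j,j\in[m]}$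 is a g-frame for $\mathcal H$ with lower and upper bounds $A$ and $B$. *)

theory Defs
  imports "HOL-Analysis.Analysis"
begin

text \<open>
  Hilbert spaces are types of sort \<open>{real_inner, complete_space}\<close>. Complex Hilbert spaces are
  covered: with the real inner product \<open>Re \<langle>x, y\<rangle>\<close> they have the same norm, and their closed
  subspaces and bounded operators are closed subspaces and bounded operators over the reals.
\<close>

text \<open>
  Summability is required separately because \<open>infsum\<close> is \<open>0\<close> on families that are not
  summable, for which the upper bound would otherwise hold vacuously.
\<close>
definition g_frame ::
  "'s set \<Rightarrow> ('s \<Rightarrow> ('h::{real_inner,complete_space}) \<Rightarrow>\<^sub>L ('k::{real_inner,complete_space}))
     \<Rightarrow> real \<Rightarrow> real \<Rightarrow> bool" where
  "g_frame S \<Lambda> A B \<longleftrightarrow> 0 < A \<and> 0 < B \<and>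
     (\<forall>f. (\<lambda>s. (norm (blinfun_apply (\<Lambda> s) f))\<^sup>2) summable_on S \<and>
          A * (norm f)\<^sup>2 \<le> (\<Sum>\<^sub>\<infinity>s\<in>S. (norm (blinfun_apply (\<Lambda> s) f))\<^sup>2) \<and>
          (\<Sum>\<^sub>\<infinity>s\<in>S. (norm (blinfun_apply (\<Lambda> s) f))\<^sup>2) \<le> B * (norm f)\<^sup>2)"

definition is_indexed_partition :: "nat \<Rightarrow> nat set \<Rightarrow> (nat \<Rightarrow> nat set) \<Rightarrow> bool" where
  "is_indexed_partition m I \<sigma> \<longleftrightarrow>
     disjoint_family_on \<sigma> {1..m} \<and> (\<Union>j\<in>{1..m}. \<sigma> j) = I"

definition g_woven ::
  "nat \<Rightarrow> nat set \<Rightarrow>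
     (nat \<Rightarrow> nat \<Rightarrow> ('h::{real_inner,complete_space}) \<Rightarrow>\<^sub>L ('k::{real_inner,complete_space}))
     \<Rightarrow> real \<Rightarrow> real \<Rightarrow> bool" where
  "g_woven m I \<Lambda> A B \<longleftrightarrow>
     (\<forall>j\<in>{1..m}. \<exists>C D. g_frame I (\<lambda>i. \<Lambda> i j) C D) \<and>
     (\<forall>\<sigma>. is_indexed_partition m I \<sigma> \<longrightarrow>
        g_frame (SIGMA j:{1..m}. \<sigma> j) (\<lambda>(j, i). \<Lambda> i j) A B)"

end

theory Submission
  imports Defs
begin

text \<open>
  Split \<open>\<Sum>\<^sub>\<infinity>i\<in>I. \<parallel>\<Lambda>\<^sub>i\<^sub>j f\<parallel>\<^sup>2\<close>, which is at least \<open>A\<^sub>j \<parallel>f\<parallel>\<^sup>2\<close>, over the blocks \<open>\<sigma>\<^sub>l\<close>. On a block with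
  \<open>l \<noteq> j\<close>, the estimate \<open>\<parallel>x\<parallel>\<^sup>2 \<le> 2 \<parallel>x - y\<parallel>\<^sup>2 + 2 \<parallel>y\<parallel>\<^sup>2\<close> and the hypothesis on the differences
  replace \<open>\<Lambda>\<^sub>i\<^sub>j\<close> by \<open>\<Lambda>\<^sub>i\<^sub>l\<close> at the cost of a factor \<open>2 (K + 1)\<close>. Summing over \<open>j\<close>, each block occurs
  once with factor 1 and \<open>m - 1\<close> times with this factor.
\<close>

lemma norm_diff_sq_le:
  fixes x y :: "'a::real_normed_vector"
  shows "(norm (x - y))\<^sup>2 \<le> 2 * (norm x)\<^sup>2 + 2 * (norm y)\<^sup>2"
proof -
  have "(norm (x - y))\<^sup>2 \<le> (norm x + norm y)\<^sup>2"
    by (intro power_mono norm_triangle_ineq4) simp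
  also have "\<dots> \<le> 2 * (norm x)\<^sup>2 + 2 * (norm y)\<^sup>2"
    using sum_squares_bound[of "norm x" "norm y"] by (simp add: power2_sum)
  finally show ?thesis .
qed

text \<open>Induction over the finite outer index: each new fibre is the injective image of
  \<open>B a\<close> under \<open>Pair a\<close> and is disjoint from the earlier ones. This
  evaluates sums over a woven family, whose members are indexed by pairs.\<close>

lemma has_sum_Sigma_finite:
  fixes f :: "'a \<times> 'b \<Rightarrow> 'c::{topological_comm_monoid_add,t3_space}"
  assumes "finite A" and "\<And>x. x \<in> A \<Longrightarrow> ((\<lambda>y. f (x, y)) has_sum s x) (B x)"
  shows "(f has_sum (\<Sum>x\<in>A. s x)) (Sigma A B)"
  using assms
proof (induction A rule: finite_induct)
  case empty
  then show ?case by simp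
next
  case (insert a A)
  have "(f has_sum s a) (Pair a ` B a)"
    using insert.prems[of a] by (simp add: has_sum_reindex inj_on_def o_def)
  moreover have "(f has_sum (\<Sum>x\<in>A. s x)) (Sigma A B)"
    using insert by auto
  moreover have "Sigma (insert a A) B = Pair a ` B a \<union> Sigma A B"
    by auto
  moreover have "Pair a ` B a \<inter> Sigma A B = {}"
    using insert.hyps by auto
  ultimately show ?case
    using insert.hyps by (simp add: has_sum_Un_disjoint)
qed

text \<open>Disjointness makes \<open>snd\<close> a bijection from \<open>Sigma A \<sigma>\<close>
  onto the union, which reduces the claim to a sum over pairs. Completeness of the codomain passes
  summability from the union to each block.\<close>

lemma infsum_UN_disjoint:
  fixes g :: "'b \<Rightarrow> 'c::banach"
  assumes "finite A" and D: "disjoint_family_on \<sigma> A" and g: "g summable_on (\<Union>l\<in>A. \<sigma> l)"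
  shows "infsum g (\<Union>l\<in>A. \<sigma> l) = (\<Sum>l\<in>A. infsum g (\<sigma> l))"
proof -
  have "(g has_sum infsum g (\<sigma> l)) (\<sigma> l)" if "l \<in> A" for l
    using that by (intro has_sum_infsum summable_on_subset_banach[OF g]) blast
  then have "((g \<circ> snd) has_sum (\<Sum>l\<in>A. infsum g (\<sigma> l))) (Sigma A \<sigma>)"
    using assms(1) by (intro has_sum_Sigma_finite) auto
  moreover have "inj_on snd (Sigma A \<sigma>)"
    using D by (fastforce simp: inj_on_def disjoint_family_on_def)
  moreover have "snd ` Sigma A \<sigma> = (\<Union>l\<in>A. \<sigma> l)"
    by force
  ultimately have "(g has_sum (\<Sum>l\<in>A. infsum g (\<sigma> l))) (\<Union>l\<in>A. \<sigma> l)"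
    by (metis has_sum_reindex)
  then show ?thesis by (rule infsumI)
qed

text \<open>Transfers a sum from \<open>u\<close> to \<open>v\<close> on one block: writing
  \<open>u = (u - v) + v\<close> gives the factor 2, and \<open>d\<close> turns the difference part
  into \<open>K\<close> times the sum for \<open>v\<close>.\<close>

lemma infsum_norm_sq_le:
  fixes u v :: "'i \<Rightarrow> 'a::real_normed_vector"
  assumes u: "(\<lambda>i. (norm (u i))\<^sup>2) summable_on J" and v: "(\<lambda>i. (norm (v i))\<^sup>2) summable_on J"
    and d: "(\<Sum>\<^sub>\<infinity>i\<in>J. (norm (u i - v i))\<^sup>2) \<le> K * (\<Sum>\<^sub>\<infinity>i\<in>J. (norm (v i))\<^sup>2)"
  shows "(\<Sum>\<^sub>\<infinity>i\<in>J. (norm (u i))\<^sup>2) \<le> 2 * (K + 1) * (\<Sum>\<^sub>\<infinity>i\<in>J. (norm (v i))\<^sup>2)"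
proof -
  have uv: "(\<lambda>i. 2 * (norm (u i))\<^sup>2 + 2 * (norm (v i))\<^sup>2) summable_on J"
    using u v by (intro summable_on_add summable_on_cmult_right)
  \<comment> \<open>The bound \<open>d\<close> alone does not give this, since \<open>infsum\<close>
    is 0 on a family that is not summable.\<close>
  have w: "(\<lambda>i. (norm (u i - v i))\<^sup>2) summable_on J"
    by (rule summable_on_comparison_test[OF uv]) (auto intro: norm_diff_sq_le)
  have "(\<Sum>\<^sub>\<infinity>i\<in>J. (norm (u i))\<^sup>2)
      \<le> (\<Sum>\<^sub>\<infinity>i\<in>J. 2 * (norm (u i - v i))\<^sup>2 + 2 * (norm (v i))\<^sup>2)"
  proof (rule infsum_mono[OF u])
    show "(\<lambda>i. 2 * (norm (u i - v i))\<^sup>2 + 2 * (norm (v i))\<^sup>2) summable_on J"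
      using w v by (intro summable_on_add summable_on_cmult_right)
    show "(norm (u i))\<^sup>2 \<le> 2 * (norm (u i - v i))\<^sup>2 + 2 * (norm (v i))\<^sup>2" for i
      \<comment> \<open>The instance rests on \<open>(u i - v i) - (- v i) = u i\<close>.\<close>
      using norm_diff_sq_le[of "u i - v i" "- v i"] by simp
  qed
  also have "\<dots> = 2 * (\<Sum>\<^sub>\<infinity>i\<in>J. (norm (u i - v i))\<^sup>2) + 2 * (\<Sum>\<^sub>\<infinity>i\<in>J. (norm (v i))\<^sup>2)"
    using w v by (simp add: infsum_add summable_on_cmult_right infsum_cmult_right')
  also have "\<dots> \<le> 2 * (K + 1) * (\<Sum>\<^sub>\<infinity>i\<in>J. (norm (v i))\<^sup>2)"
    using d by (simp add: algebra_simps)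
  finally show ?thesis .
qed

theorem theorem3p5:
  fixes m :: nat
    and I :: "nat set"
    and H :: "nat \<Rightarrow> ('k::{real_inner,complete_space}) set"
    and \<Lambda> :: "nat \<Rightarrow> nat \<Rightarrow> ('h::{real_inner,complete_space}) \<Rightarrow>\<^sub>L 'k"
    and A B :: "nat \<Rightarrow> real"
    and K :: real
  assumes "m \<ge> 1"
    and "\<And>i. i \<in> I \<Longrightarrow> subspace (H i) \<and> closed (H i)"
    and "\<And>i j. i \<in> I \<Longrightarrow> j \<in> {1..m} \<Longrightarrow> range (blinfun_apply (\<Lambda> i j)) \<subseteq> H i"
    and "\<And>j. j \<in> {1..m} \<Longrightarrow> g_frame I (\<lambda>i. \<Lambda> i j) (A j) (B j)"
    and "K > 0"
    and "\<And>j l f J. j \<in> {1..m} \<Longrightarrow> l \<in> {1..m} \<Longrightarrow> j \<noteq> l \<Longrightarrow> J \<subseteq> I \<Longrightarrow>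
           (\<Sum>\<^sub>\<infinity>i\<in>J. (norm (blinfun_apply (\<Lambda> i j - \<Lambda> i l) f))\<^sup>2)
             \<le> K * min (\<Sum>\<^sub>\<infinity>i\<in>J. (norm (blinfun_apply (\<Lambda> i j) f))\<^sup>2)
                       (\<Sum>\<^sub>\<infinity>i\<in>J. (norm (blinfun_apply (\<Lambda> i l) f))\<^sup>2)"
  shows "g_woven m I \<Lambda>
           ((\<Sum>j\<in>{1..m}. A j) / (2 * (real m - 1) * (K + 1) + 1))
           (\<Sum>j\<in>{1..m}. B j)"
  unfolding g_woven_def
proof (intro conjI ballI allI impI)
  fix j assume "j \<in> {1..m}"
  then show "\<exists>C D. g_frame I (\<lambda>i. \<Lambda> i j) C D"
    using assms(4) by blast
next
  fix \<sigma> assume \<sigma>: "is_indexed_partition m I \<sigma>"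
  let ?c = "2 * (real m - 1) * (K + 1) + 1"
  have sub: "\<sigma> l \<subseteq> I" if "l \<in> {1..m}" for l
    using \<sigma> that by (auto simp: is_indexed_partition_def)
  \<comment> \<open>\<open>m \<ge> 1\<close> makes the product nonnegative; the summand 1 keeps the
    denominator positive even for \<open>m = 1\<close>.\<close>
  have c: "?c > 0"
    using assms(1,5) by (intro add_nonneg_pos mult_nonneg_nonneg) auto
  have pos: "0 < A j" "0 < B j" if "j \<in> {1..m}" for j
    using assms(4)[OF that] by (auto simp: g_frame_def)
  \<comment> \<open>Strictness needs a nonempty index set, hence \<open>m \<ge> 1\<close>.\<close>
  have posA: "0 < (\<Sum>j\<in>{1..m}. A j)" and posB: "0 < (\<Sum>j\<in>{1..m}. B j)"
    using pos assms(1) by (auto intro!: sum_pos)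
  have main: "(\<lambda>s. (norm (blinfun_apply (case s of (j, i) \<Rightarrow> \<Lambda> i j) f))\<^sup>2)
          summable_on (SIGMA j:{1..m}. \<sigma> j) \<and>
      (\<Sum>j\<in>{1..m}. A j) / ?c * (norm f)\<^sup>2
        \<le> (\<Sum>\<^sub>\<infinity>s\<in>(SIGMA j:{1..m}. \<sigma> j). (norm (blinfun_apply (case s of (j, i) \<Rightarrow> \<Lambda> i j) f))\<^sup>2) \<and>
      (\<Sum>\<^sub>\<infinity>s\<in>(SIGMA j:{1..m}. \<sigma> j). (norm (blinfun_apply (case s of (j, i) \<Rightarrow> \<Lambda> i j) f))\<^sup>2)
        \<le> (\<Sum>j\<in>{1..m}. B j) * (norm f)\<^sup>2" for f
  proof -
    define g where "g = (\<lambda>j i. (norm (blinfun_apply (\<Lambda> i j) f))\<^sup>2)"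
    define S where "S l = infsum (g l) (\<sigma> l)" for l
    have frame: "g j summable_on I" "A j * (norm f)\<^sup>2 \<le> infsum (g j) I"
        "infsum (g j) I \<le> B j * (norm f)\<^sup>2" if "j \<in> {1..m}" for j
      using assms(4)[OF that] by (auto simp: g_frame_def g_def)
    have block: "g j summable_on \<sigma> l" if "j \<in> {1..m}" "l \<in> {1..m}" for j l
      using frame(1)[OF that(1)] sub[OF that(2)] by (rule summable_on_subset_banach)
    have S0: "S l \<ge> 0" for l
      by (simp add: S_def g_def infsum_nonneg)
    \<comment> \<open>On block \<open>l\<close> the woven family uses the operators
      \<open>\<Lambda> i l\<close>, so it contributes \<open>S l\<close>. Stating this with
      \<open>has_sum\<close> yields both summability and the value.\<close>
    have hs: "((\<lambda>s. (norm (blinfun_apply (case s of (j, i) \<Rightarrow> \<Lambda> i j) f))\<^sup>2)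
        has_sum (\<Sum>l\<in>{1..m}. S l)) (SIGMA j:{1..m}. \<sigma> j)"
    proof (rule has_sum_Sigma_finite)
      fix l assume "l \<in> {1..m}"
      then show "((\<lambda>i. (norm (blinfun_apply (case (l, i) of (j, i) \<Rightarrow> \<Lambda> i j) f))\<^sup>2)
          has_sum S l) (\<sigma> l)"
        using has_sum_infsum[OF block[of l l]] by (simp add: S_def g_def)
    qed simp
    \<comment> \<open>Keeping factor 1 on the diagonal gives
      \<open>2 * (m - 1) * (K + 1) + 1\<close> instead of \<open>2 * m * (K + 1)\<close> after
      summation.\<close>
    have swap: "infsum (g j) (\<sigma> l) \<le> (if l = j then S l else 2 * (K + 1) * S l)"
      if j: "j \<in> {1..m}" and l: "l \<in> {1..m}" for j l
    proof (cases "l = j")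
      case False
      have "(\<Sum>\<^sub>\<infinity>i\<in>\<sigma> l. (norm (blinfun_apply (\<Lambda> i j) f - blinfun_apply (\<Lambda> i l) f))\<^sup>2)
          \<le> K * min (infsum (g j) (\<sigma> l)) (infsum (g l) (\<sigma> l))"
        using assms(6)[OF j l _ sub[OF l], of f] False
        by (simp add: g_def blinfun.diff_left)
      \<comment> \<open>Of the two sums in the minimum, the one kept belongs to the operators used
        on this block.\<close>
      also have "\<dots> \<le> K * infsum (g l) (\<sigma> l)"
        using assms(5) by (intro mult_left_mono) auto
      finally show ?thesis
        using infsum_norm_sq_le[of "\<lambda>i. blinfun_apply (\<Lambda> i j) f" "\<sigma> l"
            "\<lambda>i. blinfun_apply (\<Lambda> i l) f" K] block[OF j l] block[OF l l] False
        by (simp add: g_def S_def)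
    qed (simp add: S_def)
    have "(\<Sum>j\<in>{1..m}. A j) * (norm f)\<^sup>2 \<le> (\<Sum>j\<in>{1..m}. infsum (g j) I)"
      unfolding sum_distrib_right by (intro sum_mono frame(2))
    also have "\<dots> = (\<Sum>j\<in>{1..m}. \<Sum>l\<in>{1..m}. infsum (g j) (\<sigma> l))"
    proof (rule sum.cong[OF refl])
      fix j assume "j \<in> {1..m}"
      then show "infsum (g j) I = (\<Sum>l\<in>{1..m}. infsum (g j) (\<sigma> l))"
        using \<sigma> frame(1)[of j] infsum_UN_disjoint[of "{1..m}" \<sigma> "g j"]
        unfolding is_indexed_partition_def by force
    qed
    also have "\<dots> \<le> (\<Sum>j\<in>{1..m}. \<Sum>l\<in>{1..m}. if l = j then S l else 2 * (K + 1) * S l)"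
      by (intro sum_mono swap)
    \<comment> \<open>With the block \<open>l\<close> fixed and the frame \<open>j\<close> varying,
      \<open>S l\<close> factors out and only its coefficients are counted.\<close>
    also have "\<dots> = (\<Sum>l\<in>{1..m}. \<Sum>j\<in>{1..m}. if l = j then S l else 2 * (K + 1) * S l)"
      by (rule sum.swap)
    also have "\<dots> = (\<Sum>l\<in>{1..m}. ?c * S l)"
    proof (rule sum.cong[OF refl])
      fix l assume l: "l \<in> {1..m}"
      have "(\<Sum>j\<in>{1..m}. if l = j then S l else 2 * (K + 1) * S l)
          = S l + (\<Sum>j\<in>{1..m} - {l}. 2 * (K + 1) * S l)"
        using l by (subst sum.remove[of _ l]) (auto intro!: sum.cong)
      also have "\<dots> = ?c * S l"
        using l by (simp add: of_nat_diff algebra_simps)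
      finally show "(\<Sum>j\<in>{1..m}. if l = j then S l else 2 * (K + 1) * S l) = ?c * S l" .
    qed
    finally have "(\<Sum>j\<in>{1..m}. A j) * (norm f)\<^sup>2 \<le> ?c * (\<Sum>l\<in>{1..m}. S l)"
      by (simp only: sum_distrib_left)
    then have lower: "(\<Sum>j\<in>{1..m}. A j) / ?c * (norm f)\<^sup>2 \<le> (\<Sum>l\<in>{1..m}. S l)"
      using c by (simp add: pos_divide_le_eq mult.commute)
    have "S l \<le> B l * (norm f)\<^sup>2" if l: "l \<in> {1..m}" for l
    proof -
      \<comment> \<open>Enlarging \<open>\<sigma> l\<close> to \<open>I\<close> only adds
        nonnegative terms, so each block inherits the upper bound of its own frame.\<close>
      have "S l \<le> infsum (g l) I"
        unfolding S_def using block[OF l l] frame(1)[OF l] sub[OF l]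
        by (intro infsum_mono_neutral) (auto simp: g_def)
      with frame(3)[OF l] show ?thesis by linarith
    qed
    then have upper: "(\<Sum>l\<in>{1..m}. S l) \<le> (\<Sum>j\<in>{1..m}. B j) * (norm f)\<^sup>2"
      unfolding sum_distrib_right by (rule sum_mono)
    show ?thesis
      using has_sum_imp_summable[OF hs] lower upper by (simp only: infsumI[OF hs])
  qed
  show "g_frame (SIGMA j:{1..m}. \<sigma> j) (\<lambda>(j, i). \<Lambda> i j)
      ((\<Sum>j\<in>{1..m}. A j) / ?c) (\<Sum>j\<in>{1..m}. B j)"
    unfolding g_frame_def using main divide_pos_pos[OF posA c] posB by blast
qed

end
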